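(* Let $N\ge 5$ and $\alpha,l\in\mathbb{R}$, put $N'=N+\alpha$ and $\tau=l-\alpha$, and assume $2N>N'>4$ and $\tau>-4$. Let $p_s=\frac{N'+4+2\tau}{N'-4}$ and suppose $1<p<p_s$. If $u\in C^4(\mathbb{R}^N\setminus\{0\})\cap C^0(\mathbb{R}^N)$ with $|x|^\alpha\Delta u\in C^0(\mathbb{R}^N)$ is a nonnegative radial solution of $$\Delta(|x|^\alpha\Delta u)=|x|^l u^p\quad\text{in }\mathbb{R}^N,$$ then $u\equiv 0$ in $\mathbb{R}^N$.
   Context: A nonnegative solution of the equation in $\mathbb{R}^N$ means a function $u\ge 0$ with the stated regularity that satisfies the equation pointwise in $\mathbb{R}^N\setminus\{0\}$. The condition $|x|^\alpha\Delta u\in C^0(\mathbb{R}^N)$ means that the function $|x|^\alpha\Delta u$, defined on $\mathbb{R}^N\setminus\{0\}$, extends continuously to $\mathbb{R}^N$. Radial means $u(x)=u(|x|)$. *)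

theory Defs
  imports "HOL-Analysis.Analysis"
begin

definition partial_deriv :: "'a::euclidean_space \<Rightarrow> ('a \<Rightarrow> real) \<Rightarrow> 'a \<Rightarrow> real" where
  "partial_deriv b f x = deriv (\<lambda>t. f (x + t *\<^sub>R b)) 0"

definition laplacian :: "('a::euclidean_space \<Rightarrow> real) \<Rightarrow> 'a \<Rightarrow> real" where
  "laplacian f x = (\<Sum>b\<in>Basis. partial_deriv b (partial_deriv b f) x)"

(* Meant for open S: all partial derivatives of order at most k exist on S and are
   continuous there.  The differentiability clause is needed because deriv is a total
   function with an arbitrary value where the derivative does not exist. *)
primrec C_k_on :: "nat \<Rightarrow> 'a::euclidean_space set \<Rightarrow> ('a \<Rightarrow> real) \<Rightarrow> bool" where
  "C_k_on 0 S f \<longleftrightarrow> continuous_on S f"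
| "C_k_on (Suc k) S f \<longleftrightarrow> continuous_on S f \<and>
     (\<forall>b\<in>Basis. (\<forall>x\<in>S. (\<lambda>t. f (x + t *\<^sub>R b)) differentiable (at 0)) \<and>
        C_k_on k S (partial_deriv b f))"

definition extends_continuously :: "('a::euclidean_space \<Rightarrow> real) \<Rightarrow> bool" where
  "extends_continuously f \<longleftrightarrow>
     (\<exists>g. continuous_on UNIV g \<and> (\<forall>x. x \<noteq> 0 \<longrightarrow> g x = f x))"

definition radial :: "('a::euclidean_space \<Rightarrow> real) \<Rightarrow> bool" where
  "radial u \<longleftrightarrow> (\<exists>v. \<forall>x. u x = v (norm x))"

(* The equation is imposed only away from the origin, where norm x > 0; there powr is
   the usual real power, and for p > 0 also 0 powr p = 0, as required at zeros of u. *)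
definition nonneg_solution ::
  "real \<Rightarrow> real \<Rightarrow> real \<Rightarrow> ('a::euclidean_space \<Rightarrow> real) \<Rightarrow> bool" where
  "nonneg_solution \<alpha> l p u \<longleftrightarrow>
     C_k_on 4 (- {0}) u \<and> continuous_on UNIV u \<and>
     extends_continuously (\<lambda>x. norm x powr \<alpha> * laplacian u x) \<and>
     (\<forall>x. 0 \<le> u x) \<and>
     (\<forall>x. x \<noteq> 0 \<longrightarrow>
        laplacian (\<lambda>y. norm y powr \<alpha> * laplacian u y) x = norm x powr l * u x powr p)"

end

theory Submission
  imports Defs "HOL-Real_Asymp.Real_Asymp"
begin

text \<open>
  Write \<open>n\<close> for the dimension, \<open>u(r)\<close> for the profile and \<open>w = r\<^bsup>\<alpha>\<^esup> \<Delta>u\<close>. On \<open>r > 0\<close> the equation is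
  the system \<open>(r\<^bsup>n-1\<^esup> u')' = r\<^bsup>n-1-\<alpha>\<^esup> w\<close>, \<open>(r\<^bsup>n-1\<^esup> w')' = r\<^bsup>n-1+l\<^esup> u\<^bsup>p\<^esup>\<close> with \<open>u\<close> and
  \<open>w\<close> bounded near the origin (\<open>profile_system\<close>). The theorem is a radial Pohozaev argument, for
  which three facts are needed.

  Signs. Boundedness at the origin makes the flux \<open>r\<^bsup>n-1\<^esup> w'\<close> nonnegative (\<open>flux_nonneg\<close>), so
  \<open>w\<close> is nondecreasing. If \<open>w\<close> became positive, \<open>u\<close> would eventually be positive, increasing
  and subject to \<open>u(r(1+h)) \<ge> c r\<^bsup>4+\<tau>\<^esup> h\<^sup>4 u(r)\<^bsup>p\<^esup>\<close> for \<open>0 < h \<le> 1\<close>. Since \<open>p > 1\<close> this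
  blows up at a finite radius (\<open>superlinear_blowup\<close>). Hence \<open>w \<le> 0\<close> (\<open>w_nonpos\<close>), \<open>u\<close> is
  nonincreasing, and \<open>u\<close> is either identically zero or everywhere positive (\<open>zero_of_zero\<close>).

  Decay. Integrating the system over dyadic intervals gives \<open>u(r) \<ge> c r\<^bsup>4+\<tau>\<^esup> u(4r)\<^bsup>p\<^esup>\<close>.
  Iterated, this yields \<open>u = O(r\<^bsup>-\<theta>\<^esup>)\<close> with \<open>\<theta> = (4+\<tau>)/(p-1)\<close> (\<open>u_decay\<close>), and
  \<open>w = O(r\<^bsup>\<alpha>-2-\<theta>\<^esup>)\<close>. Monotonicity of the fluxes gives \<open>r |u'| \<le> K u\<close> and
  \<open>r |w'| \<le> K |w|\<close> (\<open>flux_le\<close>).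

  Pohozaev identity. A suitable combination of \<open>r\<^sup>n u' w'\<close>, \<open>r\<^bsup>n-\<alpha>\<^esup> w\<^sup>2\<close>,
  \<open>r\<^bsup>n+l\<^esup> u\<^bsup>p+1\<^esup>\<close>, \<open>r\<^bsup>n-1\<^esup> u' w\<close> and \<open>r\<^bsup>n-1\<^esup> u w'\<close> has derivative
  \<open>((n+l)/(p+1) - (N'-4)/2) r\<^bsup>n+l-1\<^esup> u\<^bsup>p+1\<^esup>\<close> (\<open>pohozaev_DERIV\<close>), and the bracket is
  positive exactly for \<open>p < p\<^sub>s\<close>. The bounds above show that the combination tends to \<open>0\<close> at the
  origin, and it is \<open>O(r\<^bsup>N'-4-2\<theta>\<^esup>)\<close> at infinity, where \<open>N'-4-2\<theta> < 0\<close> says again that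
  \<open>p < p\<^sub>s\<close>. For a positive \<open>u\<close> it would be strictly increasing with limit \<open>0\<close> at both ends.
\<close>

section \<open>The Laplacian of radial functions\<close>

lemma DERIV_norm_line:
  fixes y b :: "'a::euclidean_space"
  assumes "y \<noteq> 0"
  shows "((\<lambda>t. norm (y + t *\<^sub>R b)) has_real_derivative (y \<bullet> b) / norm y) (at 0)"
proof -
  have eq: "norm (y + t *\<^sub>R b) = sqrt ((norm y)\<^sup>2 + 2 * t * (y \<bullet> b) + t\<^sup>2 * (b \<bullet> b))" for t
    by (simp add: norm_eq_sqrt_inner inner_simps power2_eq_square inner_commute algebra_simps)
  show ?thesis unfolding eq
    using assms by (auto intro!: derivative_eq_intros simp: field_simps)
qed

lemma eventually_line_nonzero:
  fixes y b :: "'a::euclidean_space"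
  assumes "y \<noteq> 0"
  shows "\<forall>\<^sub>F t in nhds 0. y + t *\<^sub>R b \<noteq> 0"
proof -
  have "((\<lambda>t. y + t *\<^sub>R b) \<longlongrightarrow> y + 0 *\<^sub>R b) (nhds (0::real))"
    by (intro tendsto_intros filterlim_ident)
  then show ?thesis using assms by (intro tendsto_imp_eventually_ne) auto
qed

lemma partial_deriv_radial:
  fixes f :: "'a::euclidean_space \<Rightarrow> real"
  assumes f: "\<And>x. x \<noteq> 0 \<Longrightarrow> f x = h (norm x)"
    and h: "\<And>s. 0 < s \<Longrightarrow> (h has_real_derivative h1 s) (at s)"
    and y: "y \<noteq> 0"
  shows "partial_deriv b f y = h1 (norm y) * ((y \<bullet> b) / norm y)"
proof -
  have "((\<lambda>t. h (norm (y + t *\<^sub>R b))) has_real_derivative h1 (norm y) * ((y \<bullet> b) / norm y)) (at 0)"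
    by (rule DERIV_chain2[where f=h and g="\<lambda>t. norm (y + t *\<^sub>R b)" and x=0 and s=UNIV])
       (use y h DERIV_norm_line[OF y] in auto)
  moreover have "\<forall>\<^sub>F t in nhds 0. f (y + t *\<^sub>R b) = h (norm (y + t *\<^sub>R b))"
    using eventually_line_nonzero[OF y, of b] by (rule eventually_mono) (simp add: f)
  ultimately show ?thesis
    unfolding partial_deriv_def by (intro DERIV_imp_deriv) (simp add: DERIV_cong_ev)
qed

text \<open>Each pure second derivative is
  \<open>h'' (x \<bullet> b)\<^sup>2 / r\<^sup>2 + h' (1 / r - (x \<bullet> b)\<^sup>2 / r\<^sup>3)\<close>. Summed over the orthonormal
  basis, \<open>(x \<bullet> b)\<^sup>2\<close> gives \<open>r\<^sup>2\<close> and the constant \<open>1\<close> gives the dimension.\<close>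
lemma laplacian_radial:
  fixes f :: "'a::euclidean_space \<Rightarrow> real"
  assumes f: "\<And>x. x \<noteq> 0 \<Longrightarrow> f x = h (norm x)"
    and h: "\<And>s. 0 < s \<Longrightarrow> (h has_real_derivative h1 s) (at s)"
    and h1: "\<And>s. 0 < s \<Longrightarrow> (h1 has_real_derivative h2 s) (at s)"
    and x: "x \<noteq> 0"
  shows "laplacian f x = h2 (norm x) + (real DIM('a) - 1) / norm x * h1 (norm x)"
proof -
  define r where "r = norm x"
  have r: "0 < r" using x by (simp add: r_def)
  have second: "partial_deriv b (partial_deriv b f) x
      = (h2 r / r\<^sup>2 - h1 r / r^3) * (x \<bullet> b)\<^sup>2 + h1 r / r" if "b \<in> Basis" for b
  proof -
    have "\<forall>\<^sub>F t in nhds 0. partial_deriv b f (x + t *\<^sub>R b)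
        = h1 (norm (x + t *\<^sub>R b)) * ((x \<bullet> b + t) / norm (x + t *\<^sub>R b))"
      using eventually_line_nonzero[OF x, of b] by (rule eventually_mono)
        (use that in \<open>simp add: partial_deriv_radial[OF f h] inner_simps inner_Basis\<close>)
    moreover have "((\<lambda>t. h1 (norm (x + t *\<^sub>R b))) has_real_derivative h2 r * ((x \<bullet> b) / r)) (at 0)"
      by (rule DERIV_chain2[where f=h1 and g="\<lambda>t. norm (x + t *\<^sub>R b)" and x=0 and s=UNIV])
         (use r h1 DERIV_norm_line[OF x] in \<open>auto simp: r_def\<close>)
    then have "((\<lambda>t. h1 (norm (x + t *\<^sub>R b)) * ((x \<bullet> b + t) / norm (x + t *\<^sub>R b))) has_real_derivative
        (h2 r / r\<^sup>2 - h1 r / r^3) * (x \<bullet> b)\<^sup>2 + h1 r / r) (at 0)"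
      using r x by (auto intro!: derivative_eq_intros DERIV_norm_line
          simp: r_def[symmetric] field_simps power2_eq_square power3_eq_cube)
    ultimately show ?thesis
      unfolding partial_deriv_def[of b "partial_deriv b f"]
      by (intro DERIV_imp_deriv) (simp add: DERIV_cong_ev)
  qed
  have "laplacian f x = (h2 r / r\<^sup>2 - h1 r / r^3) * (\<Sum>b\<in>Basis. (x \<bullet> b)\<^sup>2) + DIM('a) * (h1 r / r)"
    by (simp add: laplacian_def second sum.distrib sum_distrib_left)
  also have "(\<Sum>b\<in>Basis. (x \<bullet> b)\<^sup>2) = r\<^sup>2"
    unfolding r_def by (simp add: norm_eq_sqrt_inner euclidean_inner[of x x] power2_eq_square sum_nonneg)
  also have "(h2 r / r\<^sup>2 - h1 r / r^3) * r\<^sup>2 = h2 r - h1 r / r"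
    using r by (simp add: left_diff_distrib power2_eq_square power3_eq_cube)
  finally show ?thesis
    by (simp add: r_def[symmetric] diff_divide_distrib algebra_simps)
qed

text \<open>Since \<open>partial_deriv b f\<close> is again of class \<open>C_k_on k\<close>, iterating this lemma yields the
  higher derivatives of a radial profile without any change of variables.\<close>
lemma C_k_on_ray_DERIV:
  fixes f :: "'a::euclidean_space \<Rightarrow> real"
  assumes "C_k_on (Suc k) (- {0}) f" "b \<in> Basis" "0 < s"
  shows "((\<lambda>s. f (s *\<^sub>R b)) has_real_derivative partial_deriv b f (s *\<^sub>R b)) (at s)"
proof -
  have "s *\<^sub>R b \<in> - {0}" using assms by (auto simp: nonzero_Basis)
  then have "(\<lambda>t. f (s *\<^sub>R b + t *\<^sub>R b)) differentiable (at 0)"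
    using assms by auto
  then have "((\<lambda>t. f (s *\<^sub>R b + t *\<^sub>R b)) has_real_derivative partial_deriv b f (s *\<^sub>R b)) (at 0)"
    unfolding partial_deriv_def by (simp add: DERIV_deriv_iff_real_differentiable)
  then show ?thesis
    using DERIV_shift[of "\<lambda>s. f (s *\<^sub>R b)" "partial_deriv b f (s *\<^sub>R b)" 0 s]
    by (simp add: scaleR_add_left add.commute)
qed

section \<open>One-dimensional flux estimates\<close>

lemma nondecreasing_of_weighted_deriv:
  fixes f g :: "real \<Rightarrow> real"
  assumes "a \<le> b"
    and d: "\<And>x. a \<le> x \<Longrightarrow> x \<le> b \<Longrightarrow> (f has_real_derivative x powr e * g x) (at x)"
    and g: "\<And>x. a \<le> x \<Longrightarrow> x \<le> b \<Longrightarrow> 0 \<le> g x"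
  shows "f a \<le> f b"
  by (rule DERIV_nonneg_imp_nondecreasing[OF assms(1)])
     (meson d g mult_nonneg_nonneg powr_ge_zero)

lemma nonincreasing_of_weighted_deriv:
  fixes f g :: "real \<Rightarrow> real"
  assumes "a \<le> b"
    and d: "\<And>x. a \<le> x \<Longrightarrow> x \<le> b \<Longrightarrow> (f has_real_derivative x powr e * g x) (at x)"
    and g: "\<And>x. a \<le> x \<Longrightarrow> x \<le> b \<Longrightarrow> g x \<le> 0"
  shows "f b \<le> f a"
  by (rule DERIV_nonpos_imp_nonincreasing[OF assms(1)])
     (meson d g mult_nonneg_nonpos powr_ge_zero)

text \<open>A negative value of \<open>F\<close> would persist towards the origin by monotonicity, so that \<open>f\<close>
  would grow at least like a multiple of the fundamental solution \<open>r\<^bsup>2-n\<^esup>\<close> as \<open>r \<rightarrow> 0\<close>.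
  This is the step in which boundedness at the origin excludes a point source there.\<close>
lemma flux_nonneg:
  fixes n B :: real
  assumes n: "2 < n"
    and df: "\<And>r. 0 < r \<Longrightarrow> (f has_real_derivative r powr (1 - n) * F r) (at r)"
    and mono: "\<And>r s. 0 < r \<Longrightarrow> r \<le> s \<Longrightarrow> F r \<le> F s"
    and bounded: "\<And>r. 0 < r \<Longrightarrow> r \<le> 1 \<Longrightarrow> \<bar>f r\<bar> \<le> B"
    and R: "0 < R"
  shows "0 \<le> F R"
proof (rule ccontr)
  assume "\<not> 0 \<le> F R"
  \<comment> \<open>With this \<open>a\<close>, the function \<open>a r\<^bsup>2-n\<^esup>\<close> has constant flux \<open>F R\<close>.\<close>
  define a where "a = - F R / (n - 2)"
  have a: "0 < a" using \<open>\<not> 0 \<le> F R\<close> n by (simp add: a_def divide_neg_pos)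
  define g where "g = (\<lambda>r. f r - a * r powr (2 - n))"
  have g: "g R \<le> g r" if "0 < r" "r \<le> R" for r
  proof (rule DERIV_nonpos_imp_nonincreasing[OF that(2)])
    fix x assume x: "r \<le> x" "x \<le> R"
    then have "0 < x" using that by simp
    have "(g has_real_derivative x powr (1 - n) * (F x + a * (n - 2))) (at x)"
      unfolding g_def using \<open>0 < x\<close>
      by (auto intro!: derivative_eq_intros df simp: algebra_simps)
    moreover have "F x + a * (n - 2) \<le> 0" using mono[OF \<open>0 < x\<close> x(2)] n by (simp add: a_def)
    ultimately show "\<exists>y. (g has_real_derivative y) (at x) \<and> y \<le> 0"
      by (meson mult_nonneg_nonpos powr_ge_zero)
  qed
  have "filterlim (\<lambda>r. a * r powr (2 - n)) at_top (at_right 0)"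
    using n a by real_asymp
  then have "\<forall>\<^sub>F r in at_right 0. B - g R < a * r powr (2 - n)"
    by (rule filterlim_at_top_dense[THEN iffD1, rule_format])
  moreover have "\<forall>\<^sub>F r in at_right 0. r \<in> {0<..<min 1 R}"
    using R by (intro eventually_at_right_real) simp
  ultimately have "\<forall>\<^sub>F r in at_right (0::real). False"
  proof eventually_elim
    case (elim r)
    then show False using g[of r] bounded[of r] by (simp add: g_def)
  qed
  then show False by simp
qed

lemma powr_ge_on_double:
  fixes r x a :: real
  assumes "0 < r" "r \<le> x" "x \<le> 2 * r"
  shows "min 1 (2 powr a) * r powr a \<le> x powr a"
proof (cases "0 \<le> a")
  case True
  have "min 1 (2 powr a) * r powr a \<le> 1 * r powr a"
    by (intro mult_right_mono) auto
  also have "\<dots> \<le> x powr a" using True assms by (simp add: powr_mono2)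
  finally show ?thesis .
next
  case False
  have "min 1 (2 powr a) * r powr a \<le> 2 powr a * r powr a"
    by (intro mult_right_mono) auto
  also have "\<dots> = (2 * r) powr a" using assms by (simp add: powr_mult)
  also have "\<dots> \<le> x powr a" using False assms by (intro powr_mono2') auto
  finally show ?thesis .
qed

text \<open>The constant of the growth estimate below. The minimum bounds \<open>(x / r)\<^bsup>m-1\<^esup>\<close> and the
  middle factor \<open>(x / r)\<^bsup>1-n\<^esup>\<close> from below for \<open>x\<close> between \<open>r\<close> and \<open>2 r\<close>; the half comes from
  integrating twice.\<close>
definition flux_const :: "real \<Rightarrow> real \<Rightarrow> real" where
  "flux_const n m = min 1 (2 powr (m - 1)) * 2 powr (1 - n) / 2"

lemma flux_const_pos: "0 < flux_const n m"
  by (simp add: flux_const_def)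

text \<open>The basic quantitative step: a source of size \<open>A x\<^bsup>m-1\<^esup>\<close> forces \<open>F\<close> to grow linearly
  and hence \<open>f\<close> to grow quadratically in the increment \<open>r h\<close>. The explicit dependence on \<open>h\<close> is
  what the blow-up argument uses; the decay estimates take \<open>h = 1\<close>.\<close>
lemma flux_growth:
  fixes n m :: real
  assumes n: "1 \<le> n" and r: "0 < r" and h: "0 \<le> h" "h \<le> 1" and A: "0 \<le> A" and F: "0 \<le> F r"
    and df: "\<And>x. r \<le> x \<Longrightarrow> x \<le> 2 * r \<Longrightarrow> (f has_real_derivative x powr (1 - n) * F x) (at x)"
    and dF: "\<And>x. r \<le> x \<Longrightarrow> x \<le> 2 * r \<Longrightarrow> (F has_real_derivative F' x) (at x)"
    and F': "\<And>x. r \<le> x \<Longrightarrow> x \<le> 2 * r \<Longrightarrow> A * x powr (m - 1) \<le> F' x"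
  shows "flux_const n m * A * r powr (m + 2 - n) * h\<^sup>2
    \<le> f (r * (1 + h)) - f r"
proof -
  define k where "k = min 1 (2 powr (m - 1 :: real))"
  have k: "0 \<le> k" by (simp add: k_def)
  have lower: "k * r powr (m - 1) \<le> x powr (m - 1)" if "r \<le> x" "x \<le> 2 * r" for x
    unfolding k_def by (rule powr_ge_on_double[OF r that])
  define D where "D = A * (k * r powr (m - 1))"
  have D: "0 \<le> D" using A k by (simp add: D_def)
  have F_lower: "D * (x - r) \<le> F x" if "r \<le> x" "x \<le> 2 * r" for x
  proof -
    have "F r - D * r \<le> F x - D * x"
    proof (rule DERIV_nonneg_imp_nondecreasing[OF that(1)])
      fix y assume y: "r \<le> y" "y \<le> x"
      then have y2: "y \<le> 2 * r" using that by simp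
      have "D \<le> A * y powr (m - 1)"
        unfolding D_def using y y2 by (intro mult_left_mono lower A)
      then have "0 \<le> F' y - D" using F'[OF y(1) y2] by simp
      moreover have "((\<lambda>x. F x - D * x) has_real_derivative F' y - D) (at y)"
        using dF[OF y(1) y2] by (auto intro!: derivative_eq_intros)
      ultimately show "\<exists>z. ((\<lambda>x. F x - D * x) has_real_derivative z) (at y) \<and> 0 \<le> z" by blast
    qed
    then show ?thesis using F by (simp add: algebra_simps)
  qed
  define E where "E = (2 * r) powr (1 - n) * D"
  define s where "s = r * (1 + h)"
  have s: "r \<le> s" "s \<le> 2 * r" using h r by (auto simp: s_def)
  have "f r - E / 2 * (r - r)\<^sup>2 \<le> f s - E / 2 * (s - r)\<^sup>2"
  proof (rule DERIV_nonneg_imp_nondecreasing[OF s(1)])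
    fix y assume y: "r \<le> y" "y \<le> s"
    then have y2: "y \<le> 2 * r" using s by simp
    have "E * (y - r) = (2 * r) powr (1 - n) * (D * (y - r))" by (simp add: E_def)
    also have "\<dots> \<le> y powr (1 - n) * F y"
      using y y2 r n D by (intro mult_mono F_lower powr_mono2') auto
    finally have "0 \<le> y powr (1 - n) * F y - E * (y - r)" by simp
    moreover have "((\<lambda>x. f x - E / 2 * (x - r)\<^sup>2) has_real_derivative
        y powr (1 - n) * F y - E * (y - r)) (at y)"
      using df[OF y(1) y2] by (auto intro!: derivative_eq_intros)
    ultimately show "\<exists>z. ((\<lambda>x. f x - E / 2 * (x - r)\<^sup>2) has_real_derivative z) (at y) \<and> 0 \<le> z"
      by blast
  qed
  then have "E / 2 * (r * h)\<^sup>2 \<le> f s - f r" by (simp add: s_def algebra_simps)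
  moreover have "E / 2 * (r * h)\<^sup>2 = k * 2 powr (1 - n) / 2 * A * r powr (m + 2 - n) * h\<^sup>2"
  proof -
    have "r powr (m + 2 - n) = r powr ((1 - n) + (m - 1) + 2)" by (simp add: algebra_simps)
    also have "\<dots> = r powr (1 - n) * r powr (m - 1) * r\<^sup>2"
      using r by (simp only: powr_add) simp
    finally show ?thesis using r by (simp add: E_def D_def powr_mult power2_eq_square)
  qed
  ultimately show ?thesis by (simp add: flux_const_def k_def s_def)
qed

text \<open>A monotone flux that is large at \<open>r\<close> stays large up to \<open>2 r\<close>, and then \<open>f\<close> could not
  remain nonpositive there. So derivatives are controlled by values without any compactness or
  elliptic estimate.\<close>
lemma flux_le:
  fixes n :: real
  assumes n: "1 \<le> n" and r: "0 < r"
    and df: "\<And>x. 0 < x \<Longrightarrow> (f has_real_derivative x powr (1 - n) * F x) (at x)"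
    and mono: "\<And>x y. 0 < x \<Longrightarrow> x \<le> y \<Longrightarrow> F x \<le> F y"
    and F: "0 \<le> F r" and f: "f (2 * r) \<le> 0"
  shows "F r \<le> 2 powr (n - 1) * r powr (n - 2) * (- f r)"
proof -
  define E where "E = (2 * r) powr (1 - n) * F r"
  have "f r - E * r \<le> f (2 * r) - E * (2 * r)"
  proof (rule DERIV_nonneg_imp_nondecreasing[of r "2 * r"])
    fix y assume y: "r \<le> y" "y \<le> 2 * r"
    then have "0 < y" using r by simp
    have "E \<le> y powr (1 - n) * F y"
      unfolding E_def using y r n F by (intro mult_mono powr_mono2' mono) auto
    moreover have "((\<lambda>x. f x - E * x) has_real_derivative y powr (1 - n) * F y - E) (at y)"
      using df[OF \<open>0 < y\<close>] by (auto intro!: derivative_eq_intros)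
    ultimately show "\<exists>z. ((\<lambda>x. f x - E * x) has_real_derivative z) (at y) \<and> 0 \<le> z"
      by (intro exI conjI) auto
  qed (use r in auto)
  then have "E * r \<le> - f r" using f by simp
  then have "2 powr (n - 1) * r powr (n - 2) * (E * r) \<le> 2 powr (n - 1) * r powr (n - 2) * (- f r)"
    by (intro mult_left_mono) auto
  moreover have "2 powr (n - 1) * r powr (n - 2) * (E * r) = F r"
  proof -
    have 2: "2 powr (n - 1) * 2 powr (1 - n) = (1::real)" by (simp add: powr_add[symmetric])
    have "r powr (n - 2) * r powr (1 - n) * r powr 1 = 1"
      using r by (simp only: powr_add[symmetric]) simp
    with 2 r have "(2 powr (n - 1) * 2 powr (1 - n)) * (r powr (n - 2) * r powr (1 - n) * r) = 1" by simp
    then show ?thesis using r by (simp add: E_def powr_mult algebra_simps)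
  qed
  ultimately show ?thesis by simp
qed

text \<open>With step \<open>h\<^sub>k = 2\<^bsup>-k-2\<^esup>\<close> the growth inequality loses only the geometric factor
  \<open>h\<^sub>k\<^sup>4\<close>, which the superlinear power outweighs once the starting value is large. The
  factor \<open>r\<^bsup>\<beta>\<^esup>\<close> provides such a start, and the radii stay below \<open>2 S\<close>, so \<open>g (2 S)\<close>
  would have to be infinite.\<close>
lemma superlinear_blowup:
  fixes g :: "real \<Rightarrow> real"
  assumes R: "0 < R" and p: "1 < p" and \<beta>: "0 < \<beta>" and c: "0 < c" and pos: "0 < g R"
    and mono: "\<And>r s. R \<le> r \<Longrightarrow> r \<le> s \<Longrightarrow> g r \<le> g s"
    and growth: "\<And>r h. R \<le> r \<Longrightarrow> 0 < h \<Longrightarrow> h \<le> 1 \<Longrightarrow>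
      c * r powr \<beta> * h ^ 4 * g r powr p \<le> g (r * (1 + h))"
  shows False
proof -
  \<comment> \<open>The growth rate \<open>2\<^bsup>q k\<^esup>\<close> and the start \<open>K\<close> are chosen so that one step of the
    iteration, with \<open>r\<^bsup>\<beta>\<^esup>\<close> replaced by \<open>1\<close>, reproduces the lower bound exactly:
    \<open>c h\<^sub>k\<^sup>4 (K 2\<^bsup>q k\<^esup>)\<^bsup>p\<^esup> = K 2\<^bsup>q (k + 1)\<^esup>\<close>.\<close>
  define q where "q = 4 / (p - 1)"
  define K where "K = (2 powr (8 + q) / c) powr (1 / (p - 1))"
  have K: "0 < K" using c by (simp add: K_def)
  have "K powr (p - 1) = 2 powr (8 + q) / c" using p c by (simp add: K_def powr_powr)
  then have K_eq: "c * K powr (p - 1) = 2 powr (8 + q)" using c by simp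
  obtain S where S: "R \<le> S" "1 \<le> S" "K \<le> g S"
  proof -
    have "0 < c * g R powr p" using c pos by simp
    then have "filterlim (\<lambda>r. c * g R powr p * r powr \<beta>) at_top at_top"
      using \<beta> by real_asymp
    then have "\<forall>\<^sub>F r in at_top. K \<le> c * g R powr p * r powr \<beta>"
      by (simp add: filterlim_at_top)
    moreover have "\<forall>\<^sub>F r in at_top. max R 1 \<le> r" by (rule eventually_ge_at_top)
    ultimately have "\<forall>\<^sub>F r in at_top. K \<le> c * g R powr p * r powr \<beta> \<and> max R 1 \<le> r"
      by (rule eventually_conj)
    then obtain r where r: "K \<le> c * g R powr p * r powr \<beta>" "R \<le> r" "1 \<le> r"
      by (auto dest!: eventually_happens)
    have "c * g R powr p * r powr \<beta> \<le> c * g r powr p * r powr \<beta>"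
      using c pos mono[of R r] r p by (intro mult_right_mono mult_left_mono powr_mono2) auto
    also have "\<dots> \<le> g (r * 2)" using growth[of r 1] r by (simp add: mult_ac)
    finally show thesis using that[of "r * 2"] r by simp
  qed
  have iterate: "K * 2 powr (q * k) \<le> g (S * (2 - (1/2) ^ k))" for k :: nat
  proof (induction k)
    case 0
    then show ?case using S by simp
  next
    case (Suc k)
    define r where "r = S * (2 - (1/2) ^ k)"
    have e: "0 < (1/2::real) ^ k" "(1/2::real) ^ k \<le> 1" by (auto simp: power_le_one)
    have "S * 1 \<le> r" unfolding r_def using e S by (intro mult_left_mono) auto
    then have r: "1 \<le> r" "R \<le> r" using S by auto
    define h :: real where "h = (1/2) ^ k / 4"
    have h: "0 < h" "h \<le> 1" using e by (auto simp: h_def)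
    have h4: "h ^ 4 = 2 powr (- 4 * real k - 8)"
    proof -
      have "h = 2 powr (- real k - 2)"
        by (simp add: h_def powr_diff powr_minus powr_realpow power_one_over inverse_eq_divide)
      then have "h ^ 4 = (2 powr (- real k - 2)) powr 4" using h by simp
      then show ?thesis by (simp add: powr_powr algebra_simps)
    qed
    have "K * 2 powr (q * Suc k) = c * 1 * h ^ 4 * (K * 2 powr (q * k)) powr p"
    proof -
      have qp: "q * p = q + 4" using p by (simp add: q_def field_simps)
      have Kp: "K powr p = K * K powr (p - 1)" using K by (simp add: powr_diff)
      have "q * real k * p = (q * p) * k" by simp
      then have qkp: "q * real k * p = q * k + 4 * k"
        by (simp only: qp distrib_right)
      have "c * 1 * h ^ 4 * (K * 2 powr (q * k)) powr p
          = K * (c * K powr (p - 1)) * (h ^ 4 * 2 powr (q * k * p))"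
        using K by (simp add: powr_mult powr_powr Kp)
      also have "\<dots> = K * (2 powr (8 + q) * 2 powr (- 4 * real k - 8) * 2 powr (q * k + 4 * real k))"
        by (simp add: K_eq h4 qkp)
      also have "\<dots> = K * 2 powr (q * Suc k)"
        by (simp add: powr_add[symmetric] algebra_simps)
      finally show ?thesis ..
    qed
    also have "\<dots> \<le> c * r powr \<beta> * h ^ 4 * g r powr p"
      using Suc.IH r \<beta> c K h p
      by (intro mult_mono powr_mono2) (auto simp: r_def ge_one_powr_ge_zero)
    also have "\<dots> \<le> g (r * (1 + h))" using r h by (intro growth) auto
    also have "\<dots> \<le> g (S * (2 - (1/2) ^ Suc k))"
    proof (rule mono)
      show "R \<le> r * (1 + h)" using r h R by (simp add: order_trans[of R r])
      have "r * h \<le> S * 2 * h" using S e h unfolding r_def by (intro mult_right_mono mult_left_mono) auto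
      then show "r * (1 + h) \<le> S * (2 - (1/2) ^ Suc k)" by (simp add: r_def h_def algebra_simps)
    qed
    finally show ?case .
  qed
  have "filterlim (\<lambda>k. K * 2 powr (q * real k)) at_top at_top"
    using K p by (auto simp: q_def) real_asymp
  then have "\<forall>\<^sub>F k in at_top. g (2 * S) < K * 2 powr (q * real k)"
    by (rule filterlim_at_top_dense[THEN iffD1, rule_format])
  then obtain k where "g (2 * S) < K * 2 powr (q * real k)"
    by (auto dest!: eventually_happens)
  also note iterate[of k]
  also have "g (S * (2 - (1/2) ^ k)) \<le> g (2 * S)"
  proof (rule mono)
    have e: "0 < (1/2::real) ^ k" "(1/2::real) ^ k \<le> 1" by (auto simp: power_le_one)
    have "S * 1 \<le> S * (2 - (1/2) ^ k)" using e S by (intro mult_left_mono) auto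
    then show "R \<le> S * (2 - (1/2) ^ k)" using S by linarith
    show "S * (2 - (1/2) ^ k) \<le> 2 * S" using S by (simp add: algebra_simps)
  qed
  finally show False by simp
qed

section \<open>The radial system and the signs of its components\<close>

text \<open>The radial equation as a first order system. Besides the profiles \<open>u\<close> and
  \<open>w = r\<^bsup>\<alpha>\<^esup> \<Delta>u\<close> it contains their fluxes \<open>U = r\<^bsup>n-1\<^esup> u'\<close> and \<open>W = r\<^bsup>n-1\<^esup> w'\<close>, which
  absorb the first order terms of the radial Laplacian. The condition named \<open>subcritical\<close> is \<open>p < p\<^sub>s\<close> with denominators cleared.\<close>
locale radial_system =
  fixes n \<alpha> l p B :: real and u U w W :: "real \<Rightarrow> real"
  assumes n: "2 < n" and \<alpha>: "\<alpha> < n" and N': "4 < n + \<alpha>" and \<tau>: "-4 < l - \<alpha>"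
    and p: "1 < p" and subcritical: "(p - 1) * (n + \<alpha> - 4) < 2 * (4 + l - \<alpha>)"
    and du: "\<And>r. 0 < r \<Longrightarrow> (u has_real_derivative r powr (1 - n) * U r) (at r)"
    and dU: "\<And>r. 0 < r \<Longrightarrow> (U has_real_derivative r powr (n - 1 - \<alpha>) * w r) (at r)"
    and dw: "\<And>r. 0 < r \<Longrightarrow> (w has_real_derivative r powr (1 - n) * W r) (at r)"
    and dW: "\<And>r. 0 < r \<Longrightarrow> (W has_real_derivative r powr (n - 1 + l) * u r powr p) (at r)"
    and u_nonneg: "\<And>r. 0 < r \<Longrightarrow> 0 \<le> u r"
    and u_le: "\<And>r. 0 < r \<Longrightarrow> r \<le> 1 \<Longrightarrow> u r \<le> B"
    and w_le: "\<And>r. 0 < r \<Longrightarrow> r \<le> 1 \<Longrightarrow> \<bar>w r\<bar> \<le> B"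
begin

lemma W_mono: "0 < r \<Longrightarrow> r \<le> s \<Longrightarrow> W r \<le> W s"
  by (rule nondecreasing_of_weighted_deriv[OF _ dW]) auto

lemma W_nonneg: "0 < r \<Longrightarrow> 0 \<le> W r"
  using n dw W_mono w_le by (rule flux_nonneg)

lemma w_mono: "0 < r \<Longrightarrow> r \<le> s \<Longrightarrow> w r \<le> w s"
  by (rule nondecreasing_of_weighted_deriv[OF _ dw]) (auto intro: W_nonneg)

text \<open>If \<open>w\<close> were positive somewhere, it would stay bounded below by a positive constant from there
  on, so the flux \<open>U\<close> would tend to infinity because \<open>n - \<alpha> > 0\<close>. Then \<open>u\<close> is eventually
  positive and increasing, and two applications of the growth estimate put it under the superlinear
  inequality that forces blow-up at a finite radius.\<close>
lemma w_nonpos: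
  assumes r0: "0 < r0"
  shows "w r0 \<le> 0"
proof (rule ccontr)
  assume "\<not> w r0 \<le> 0"
  define c where "c = w r0 / (n - \<alpha>)"
  have c: "0 < c" using \<open>\<not> w r0 \<le> 0\<close> \<alpha> by (simp add: c_def)
  have w_pos: "0 < w r" if "r0 \<le> r" for r
    using w_mono[OF r0 that] \<open>\<not> w r0 \<le> 0\<close> by simp
  have U_mono: "U r \<le> U s" if "r0 \<le> r" "r \<le> s" for r s
    using r0 that by (intro nondecreasing_of_weighted_deriv[OF that(2) dU]) (auto intro!: less_imp_le[OF w_pos])
  have U_lower: "U r0 - c * r0 powr (n - \<alpha>) \<le> U r - c * r powr (n - \<alpha>)" if "r0 \<le> r" for r
  proof (rule DERIV_nonneg_imp_nondecreasing[OF that])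
    fix x assume x: "r0 \<le> x" "x \<le> r"
    have "((\<lambda>r. U r - c * r powr (n - \<alpha>)) has_real_derivative
        x powr (n - 1 - \<alpha>) * (w x - c * (n - \<alpha>))) (at x)"
      using x r0 by (auto intro!: derivative_eq_intros dU simp: algebra_simps)
    moreover have "0 \<le> w x - c * (n - \<alpha>)" using w_mono[OF r0 x(1)] \<alpha> by (simp add: c_def)
    ultimately show "\<exists>y. ((\<lambda>r. U r - c * r powr (n - \<alpha>)) has_real_derivative y) (at x) \<and> 0 \<le> y"
      by (meson mult_nonneg_nonneg powr_ge_zero)
  qed
  obtain R where R: "r0 \<le> R" "0 < U R"
  proof -
    have "filterlim (\<lambda>r. c * r powr (n - \<alpha>)) at_top at_top"
      using c \<alpha> by real_asymp
    then have "\<forall>\<^sub>F r in at_top. c * r0 powr (n - \<alpha>) - U r0 < c * r powr (n - \<alpha>)"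
      by (rule filterlim_at_top_dense[THEN iffD1, rule_format])
    moreover have "\<forall>\<^sub>F r in at_top. r0 \<le> r" by (rule eventually_ge_at_top)
    ultimately have "\<forall>\<^sub>F r in at_top. r0 \<le> r \<and> 0 < U r"
      by eventually_elim (use U_lower in force)
    then show thesis using that by (auto dest!: eventually_happens)
  qed
  have U_pos: "0 < U r" if "R \<le> r" for r
    using U_mono[OF R(1) that] R by simp
  have u_mono: "u r \<le> u s" if "R \<le> r" "r \<le> s" for r s
    using R r0 that by (intro nondecreasing_of_weighted_deriv[OF that(2) du]) (auto intro!: less_imp_le[OF U_pos])
  have "u R < u (R + 1)"
  proof (rule DERIV_pos_imp_increasing[of R "R + 1"])
    fix x assume x: "R \<le> x" "x \<le> R + 1"
    then have "(u has_real_derivative x powr (1 - n) * U x) (at x)" using R r0 by (intro du) simp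
    moreover have "0 < x powr (1 - n) * U x" using x R r0 U_pos[of x] by simp
    ultimately show "\<exists>y. (u has_real_derivative y) (at x) \<and> 0 < y" by blast
  qed simp
  then have u_pos: "0 < u (R + 1)" using u_nonneg[of R] R r0 by simp
  define C where "C = flux_const n (n - \<alpha>) * flux_const n (n + l) * min 1 (2 powr (2 - \<alpha>)) / 81"
  show False
  proof (rule superlinear_blowup[where g = u and c = C and \<beta> = "4 + l - \<alpha>" and p = p])
    show "0 < R + 1" using R r0 by simp
    show "1 < p" by (rule p)
    show "0 < 4 + l - \<alpha>" using \<tau> by simp
    show "0 < C" by (simp add: C_def flux_const_pos)
    show "0 < u (R + 1)" by (rule u_pos)
    show "u r \<le> u s" if "R + 1 \<le> r" "r \<le> s" for r s using that by (intro u_mono) auto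
    fix r h :: real assume r: "R + 1 \<le> r" and h: "0 < h" "h \<le> 1"
    have r': "0 < r" "r0 \<le> r" "R \<le> r" using r R r0 by auto
    \<comment> \<open>One factor \<open>1 + h / 3\<close> is spent on \<open>w\<close>, a second one on \<open>u\<close>;
      \<open>(1 + h / 3)\<^sup>2 \<le> 1 + h\<close> keeps the two within the radius \<open>r (1 + h)\<close>.\<close>
    define k where "k = h / 3"
    have k: "0 < k" "k \<le> 1" using h by (auto simp: k_def)
    define s where "s = r * (1 + k)"
    have s: "r \<le> s" "s \<le> 2 * r" using r' k by (auto simp: s_def)
    have s': "0 < s" "r0 \<le> s" "R \<le> s" using s r' by auto
    have "flux_const n (n + l) * u r powr p * r powr (n + l + 2 - n) * k\<^sup>2 \<le> w (r * (1 + k)) - w r"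
    proof (rule flux_growth[where F = W])
      show "u r powr p * x powr (n + l - 1) \<le> x powr (n - 1 + l) * u x powr p" if "r \<le> x" for x
      proof -
        have "u r powr p \<le> u x powr p" using p that r' u_nonneg by (intro powr_mono2 u_mono) auto
        then have "x powr (n - 1 + l) * u r powr p \<le> x powr (n - 1 + l) * u x powr p"
          by (rule mult_left_mono) simp
        then show ?thesis by (simp add: algebra_simps)
      qed
    qed (use n r' k W_nonneg dw dW in auto)
    then have w_ge: "flux_const n (n + l) * u r powr p * r powr (l + 2) * k\<^sup>2 \<le> w s"
      using w_pos[OF r'(2)] by (simp add: s_def)
    have "flux_const n (n - \<alpha>) * w s * s powr (n - \<alpha> + 2 - n) * k\<^sup>2 \<le> u (s * (1 + k)) - u s"
    proof (rule flux_growth[where F = U])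
      show "w s * x powr (n - \<alpha> - 1) \<le> x powr (n - 1 - \<alpha>) * w x" if "s \<le> x" for x
      proof -
        have "x powr (n - 1 - \<alpha>) * w s \<le> x powr (n - 1 - \<alpha>) * w x"
          using s' that by (intro mult_left_mono w_mono) auto
        then show ?thesis by (simp add: algebra_simps)
      qed
    qed (use n s' k w_pos[of s] U_pos[of s] du dU in auto)
    then have u_ge: "flux_const n (n - \<alpha>) * w s * s powr (2 - \<alpha>) * k\<^sup>2 \<le> u (s * (1 + k))"
      using u_nonneg[OF s'(1)] by simp
    have "C * r powr (4 + l - \<alpha>) * h ^ 4 * u r powr p
        = flux_const n (n - \<alpha>) * (flux_const n (n + l) * u r powr p * r powr (l + 2) * k\<^sup>2)
          * (min 1 (2 powr (2 - \<alpha>)) * r powr (2 - \<alpha>)) * k\<^sup>2"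
    proof -
      have "r powr (4 + l - \<alpha>) = r powr (l + 2) * r powr (2 - \<alpha>)"
        by (simp add: powr_add[symmetric] algebra_simps)
      then show ?thesis by (simp add: C_def k_def power_divide power_numeral_reduce)
    qed
    also have "\<dots> \<le> flux_const n (n - \<alpha>) * w s * s powr (2 - \<alpha>) * k\<^sup>2"
      using w_ge powr_ge_on_double[OF r'(1) s] w_pos[OF s'(2)]
      by (intro mult_right_mono mult_mono mult_left_mono) (auto simp: flux_const_pos less_imp_le)
    also note u_ge
    also have "u (s * (1 + k)) \<le> u (r * (1 + h))"
    proof (rule u_mono)
      show "R \<le> s * (1 + k)" using s' k by (simp add: algebra_simps add_increasing2)
      have "k * k \<le> 1 * k" using k by (intro mult_right_mono) auto
      then have "(1 + k) * (1 + k) \<le> 1 + h" by (simp add: algebra_simps k_def)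
      then show "s * (1 + k) \<le> r * (1 + h)" using r' by (simp add: s_def mult.assoc)
    qed
    finally show "C * r powr (4 + l - \<alpha>) * h ^ 4 * u r powr p \<le> u (r * (1 + h))" .
  qed
qed

lemma U_antimono: "0 < r \<Longrightarrow> r \<le> s \<Longrightarrow> U s \<le> U r"
  by (rule nonincreasing_of_weighted_deriv[OF _ dU]) (auto intro: w_nonpos)

lemma U_nonpos:
  assumes "0 < r"
  shows "U r \<le> 0"
proof -
  have "0 \<le> - U r"
  proof (rule flux_nonneg[OF n, where f = "\<lambda>r. - u r" and F = "\<lambda>r. - U r" and B = B])
    show "((\<lambda>r. - u r) has_real_derivative x powr (1 - n) * - U x) (at x)" if "0 < x" for x
      using that by (auto intro!: derivative_eq_intros du)
    show "\<bar>- u x\<bar> \<le> B" if "0 < x" "x \<le> 1" for x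
      using u_nonneg[of x] u_le[of x] that by simp
  qed (use assms U_antimono in auto)
  then show ?thesis by simp
qed

lemma u_antimono: "0 < r \<Longrightarrow> r \<le> s \<Longrightarrow> u s \<le> u r"
  by (rule nonincreasing_of_weighted_deriv[OF _ du]) (auto intro: U_nonpos)

text \<open>Beyond a zero the nonincreasing function \<open>u\<close> vanishes, so its flux is zero there. Since the
  flux is nonpositive and nonincreasing, it is zero on the whole half-line, and \<open>u\<close> is constant.\<close>
lemma zero_of_zero:
  assumes r0: "0 < r0" "u r0 = 0" and r: "0 < r"
  shows "u r = 0"
proof (cases "r0 \<le> r")
  case True
  then show ?thesis using u_antimono[of r0 r] u_nonneg[OF r] r0 by simp
next
  case False
  have zero: "u x = 0" if "r0 \<le> x" for x
    using u_antimono[of r0 x] u_nonneg[of x] r0 that by simp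
  have "((\<lambda>_. 0) has_real_derivative 0) (at (r0 + 1))" by simp
  then have d0: "(u has_real_derivative 0) (at (r0 + 1))"
    by (rule DERIV_cong_ev[THEN iffD1, rotated -1, OF _ refl _ refl])
       (rule eventually_mono[OF eventually_nhds_in_open[of "{r0<..}"]], auto simp: zero)
  have d1: "(u has_real_derivative (r0 + 1) powr (1 - n) * U (r0 + 1)) (at (r0 + 1))"
    using r0 by (intro du) simp
  have "(r0 + 1) powr (1 - n) * U (r0 + 1) = 0" using d1 d0 by (rule DERIV_unique)
  then have U0: "U (r0 + 1) = 0" using r0 by simp
  have U: "U x = 0" if "0 < x" "x \<le> r0" for x
    using U_nonpos[OF that(1)] U_antimono[of x "r0 + 1"] U0 that by simp
  have "u r0 = u r"
  proof (rule DERIV_isconst_end[of r r0])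
    show "r < r0" using False by simp
    show "continuous_on {r..r0} u"
      using r by (intro DERIV_continuous_on[where D = "\<lambda>r. r powr (1 - n) * U r"])
        (auto intro!: DERIV_subset[OF du])
    show "(u has_real_derivative 0) (at x)" if "r < x" "x < r0" for x
      using du[of x] U[of x] that r by simp
  qed
  then show ?thesis using r0 by simp
qed

section \<open>Decay at infinity\<close>

text \<open>The next two estimates form a chain \<open>u(2r)\<^bsup>p\<^esup> \<lesssim> - w(r)\<close> and
  \<open>- w(2r) \<lesssim> u(r)\<close> up to powers of \<open>r\<close>. Composed, they bound \<open>u(4r)\<^bsup>p\<^esup>\<close> by \<open>u(r)\<close>, which
  for \<open>p > 1\<close> is a decay estimate.\<close>
lemma w_ge:
  assumes r: "0 < r"
  shows "flux_const n (n + l) * u (2 * r) powr p * r powr (l + 2) \<le> - w r"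
proof -
  have "flux_const n (n + l) * u (2 * r) powr p * r powr (n + l + 2 - n) * 1\<^sup>2 \<le> w (r * (1 + 1)) - w r"
  proof (rule flux_growth[where F = W])
    show "u (2 * r) powr p * x powr (n + l - 1) \<le> x powr (n - 1 + l) * u x powr p"
      if "r \<le> x" "x \<le> 2 * r" for x
    proof -
      have "u (2 * r) powr p \<le> u x powr p"
        using p that r u_nonneg by (intro powr_mono2 u_antimono) auto
      then have "x powr (n - 1 + l) * u (2 * r) powr p \<le> x powr (n - 1 + l) * u x powr p"
        by (rule mult_left_mono) simp
      then show ?thesis by (simp add: algebra_simps)
    qed
  qed (use n r W_nonneg dw dW in auto)
  then show ?thesis using w_nonpos[of "2 * r"] r by (simp add: mult.commute)
qed

lemma w_decay:
  assumes r: "0 < r"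
  shows "flux_const n (n - \<alpha>) * - w (2 * r) * r powr (2 - \<alpha>) \<le> u r"
proof -
  have "flux_const n (n - \<alpha>) * - w (2 * r) * r powr (n - \<alpha> + 2 - n) * 1\<^sup>2
      \<le> - u (r * (1 + 1)) - - u r"
  proof (rule flux_growth[where F = "\<lambda>r. - U r" and F' = "\<lambda>x. x powr (n - 1 - \<alpha>) * - w x"])
    show "- w (2 * r) * x powr (n - \<alpha> - 1) \<le> x powr (n - 1 - \<alpha>) * - w x"
      if "r \<le> x" "x \<le> 2 * r" for x
      using w_mono[of x "2 * r"] r that by (simp add: algebra_simps mult_left_mono)
  qed (use n r w_nonpos U_nonpos in \<open>auto intro!: derivative_eq_intros du dU\<close>)
  then show ?thesis using u_nonneg[of "2 * r"] r by (simp add: mult.commute)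
qed

text \<open>The exponent for which \<open>r\<^bsup>-\<theta>\<^esup>\<close> has the scaling of the equation.\<close>
definition \<theta> :: real where "\<theta> = (4 + l - \<alpha>) / (p - 1)"

text \<open>For \<open>y(r) = r\<^bsup>\<theta>\<^esup> u(r)\<close> the chain above becomes the scale invariant inequality
  \<open>y(4r)\<^bsup>p\<^esup> \<le> D y(r)\<close>. As \<open>p > 1\<close>, every bound \<open>M\<close> with \<open>M\<^bsup>p-1\<^esup> \<ge> D\<close> propagates
  from \<open>r\<close> to \<open>4 r\<close>.\<close>
lemma u_decay:
  "\<exists>M\<ge>0. \<forall>r\<ge>1. u r \<le> M * r powr - \<theta>"
proof -
  define c where "c = flux_const n (n - \<alpha>) * flux_const n (n + l) * 2 powr (l + 2)"
  have c: "0 < c" by (simp add: c_def flux_const_pos)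
  have \<theta>_pos: "0 < \<theta>" using p \<tau> by (simp add: \<theta>_def)
  have four_step: "c * r powr (4 + l - \<alpha>) * u (4 * r) powr p \<le> u r" if r: "0 < r" for r
  proof -
    have "c * r powr (4 + l - \<alpha>) * u (4 * r) powr p
        = flux_const n (n - \<alpha>) * (flux_const n (n + l) * u (2 * (2 * r)) powr p * (2 * r) powr (l + 2))
          * r powr (2 - \<alpha>)"
    proof -
      have "r powr (4 + l - \<alpha>) = r powr (l + 2) * r powr (2 - \<alpha>)"
        by (simp add: powr_add[symmetric] algebra_simps)
      then show ?thesis using r by (simp add: c_def powr_mult)
    qed
    also have "\<dots> \<le> flux_const n (n - \<alpha>) * - w (2 * r) * r powr (2 - \<alpha>)"
      using r by (intro mult_right_mono mult_left_mono w_ge) (auto simp: flux_const_pos less_imp_le)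
    also have "\<dots> \<le> u r" by (rule w_decay[OF r])
    finally show ?thesis .
  qed
  define y where "y r = r powr \<theta> * u r" for r
  have y_nonneg: "0 \<le> y r" if "0 < r" for r using u_nonneg[OF that] by (simp add: y_def)
  define D where "D = 4 powr (\<theta> * p) / c"
  have D: "0 < D" using c by (simp add: D_def)
  have y_step: "y (4 * r) powr p \<le> D * y r" if r: "0 < r" for r
  proof -
    have \<theta>p: "\<theta> * p = \<theta> + (4 + l - \<alpha>)" using p by (simp add: \<theta>_def field_simps)
    have "y (4 * r) powr p = D * r powr \<theta> * (c * r powr (4 + l - \<alpha>) * u (4 * r) powr p)"
      using r c u_nonneg[of "4 * r"] powr_add[of r \<theta> "4 + l - \<alpha>"]
      by (simp add: y_def D_def powr_mult powr_powr \<theta>p)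
    also have "\<dots> \<le> D * r powr \<theta> * u r" using D four_step[OF r] by (intro mult_left_mono) auto
    finally show ?thesis by (simp add: y_def mult.assoc)
  qed
  define M where "M = max (D powr (1 / (p - 1))) (4 powr \<theta> * u 1)"
  have M: "0 < M" using D by (simp add: M_def less_max_iff_disj)
  have "D = (D powr (1 / (p - 1))) powr (p - 1)" using D p by (simp add: powr_powr)
  also have "\<dots> \<le> M powr (p - 1)" using p by (intro powr_mono2) (auto simp: M_def)
  finally have "D * M \<le> M powr (p - 1) * M" using M by (intro mult_right_mono) auto
  also have "\<dots> = M powr p" using M by (simp add: powr_diff)
  finally have DM: "D * M \<le> M powr p" .
  have y_le: "y r \<le> M" if "1 \<le> r" "r \<le> 4 ^ Suc k" for r k
    using that
  proof (induction k arbitrary: r)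
    case 0
    have "y r \<le> 4 powr \<theta> * u 1"
      unfolding y_def using 0 \<theta>_pos u_nonneg by (intro mult_mono powr_mono2 u_antimono) auto
    then show ?case by (simp add: M_def)
  next
    case (Suc k)
    show ?case
    proof (cases "r \<le> 4 ^ Suc k")
      case True
      then show ?thesis by (rule Suc.IH[OF Suc.prems(1)])
    next
      case False
      have "(1::real) \<le> 4 ^ k" by simp
      then have "4 \<le> r" using False unfolding power_Suc by linarith
      then have r4: "1 \<le> r / 4" "r / 4 \<le> 4 ^ Suc k" using Suc.prems by auto
      have "y r powr p \<le> D * y (r / 4)" using y_step[of "r / 4"] r4 by simp
      also have "\<dots> \<le> D * M" using Suc.IH[OF r4] D by (intro mult_left_mono) auto
      also note DM
      finally show ?thesis
        using powr_less_mono2[of p M "y r"] M p by (force simp: not_le[symmetric])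
    qed
  qed
  show ?thesis
  proof (intro exI[of _ M] conjI allI impI)
    show "0 \<le> M" using M by simp
    fix r :: real assume r: "1 \<le> r"
    obtain k where "r < 4 ^ k" using real_arch_pow[of 4 r] by auto
    also have "(4::real) ^ k \<le> 4 ^ Suc k" by simp
    finally have "y r \<le> M" using y_le[OF r, of k] by simp
    then have "r powr - \<theta> * y r \<le> r powr - \<theta> * M" by (intro mult_left_mono) auto
    then show "u r \<le> M * r powr - \<theta>"
      using r by (simp add: y_def powr_minus field_simps)
  qed
qed

section \<open>The Pohozaev argument\<close>

text \<open>The Pohozaev function of the Hamiltonian system formed by \<open>u\<close> and \<open>- w\<close>: the first three terms
  are the energy \<open>r\<^sup>n (- u' w' + r\<^bsup>-\<alpha>\<^esup> w\<^sup>2 / 2 + r\<^sup>l u\<^bsup>p+1\<^esup> / (p + 1))\<close>. The coefficients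
  \<open>- a\<close> of \<open>U w\<close> and \<open>- b\<close> of \<open>u W\<close> are determined by the derivative: \<open>w\<^sup>2\<close> drops out for
  \<open>a = (n - \<alpha>) / 2\<close>, and \<open>U W\<close> drops out for \<open>a + b = n - 2\<close>.\<close>
definition pohozaev :: "real \<Rightarrow> real" where
  "pohozaev r = - (r powr (2 - n) * U r * W r) + r powr (n - \<alpha>) * (w r)\<^sup>2 / 2
     + r powr (n + l) * u r powr (p + 1) / (p + 1)
     - (n - \<alpha>) / 2 * (U r * w r) - (n + \<alpha> - 4) / 2 * (u r * W r)"

text \<open>Only the source term survives, with a coefficient whose sign is decided by comparing \<open>p\<close> with
  the critical exponent.\<close>
lemma pohozaev_DERIV:
  assumes r: "0 < r" and pos: "0 < u r"
  shows "(pohozaev has_real_derivative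
    ((n + l) / (p + 1) - (n + \<alpha> - 4) / 2) * (r powr (n + l - 1) * u r powr (p + 1))) (at r)"
proof -
  \<comment> \<open>Every power that occurs is one of these four, possibly times \<open>r\<close> or \<open>u r\<close>, which turns
    the identity into a polynomial one.\<close>
  define q s z y where "q = r powr (1 - n)" "s = r powr (n - 1 - \<alpha>)"
    "z = r powr (n - 1 + l)" "y = u r powr p"
  note defs = this
  have powrs: "r powr (2 - n) = r * q" "r powr (n - \<alpha>) = r * s" "r powr (n + l) = r * z"
    "r powr (n + l - 1) = z" "u r powr (p + 1) = u r * y"
  proof -
    have e: "r powr (a + 1) = r * r powr a" for a using r by (simp add: powr_add)
    show "r powr (2 - n) = r * q" "r powr (n - \<alpha>) = r * s" "r powr (n + l) = r * z"
      using e[of "1 - n"] e[of "n - 1 - \<alpha>"] e[of "n - 1 + l"] by (simp_all add: defs algebra_simps)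
    show "r powr (n + l - 1) = z" by (simp add: defs algebra_simps)
    show "u r powr (p + 1) = u r * y" using pos by (simp add: defs powr_add)
  qed
  have d1: "((\<lambda>r. r powr (2 - n)) has_real_derivative (2 - n) * q) (at r)"
    using has_real_derivative_powr[OF r, of "2 - n"] by (simp add: defs)
  have d2: "((\<lambda>r. r powr (n - \<alpha>)) has_real_derivative (n - \<alpha>) * s) (at r)"
    using has_real_derivative_powr[OF r, of "n - \<alpha>"] by (simp add: defs algebra_simps)
  have d3: "((\<lambda>r. r powr (n + l)) has_real_derivative (n + l) * z) (at r)"
    using has_real_derivative_powr[OF r, of "n + l"] by (simp add: defs algebra_simps)
  have d4: "((\<lambda>r. u r powr (p + 1)) has_real_derivative (p + 1) * y * (q * U r)) (at r)"
    using DERIV_chain2[OF has_real_derivative_powr[OF pos, of "p + 1"] du[OF r]]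
    by (simp add: defs)
  have dU': "(U has_real_derivative s * w r) (at r)" and du': "(u has_real_derivative q * U r) (at r)"
    and dW': "(W has_real_derivative z * y) (at r)" and dw': "(w has_real_derivative q * W r) (at r)"
    using dU[OF r] dW[OF r] du[OF r] dw[OF r] by (simp_all add: defs)
  have p1: "p + 1 \<noteq> 0" using p by simp
  have "(pohozaev has_real_derivative
      - (((2 - n) * q * U r + r * q * (s * w r)) * W r + r * q * U r * (z * y))
      + ((n - \<alpha>) * s * (w r)\<^sup>2 + r * s * (2 * w r * (q * W r))) / 2
      + ((n + l) * z * (u r * y) + r * z * ((p + 1) * y * (q * U r))) / (p + 1)
      - (n - \<alpha>) / 2 * (s * w r * w r + U r * (q * W r))
      - (n + \<alpha> - 4) / 2 * (q * U r * W r + u r * (z * y))) (at r)"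
    unfolding pohozaev_def[abs_def]
    by (rule d1 d2 d3 d4 dU' du' dW' dw' DERIV_cdivide[THEN DERIV_cong] derivative_eq_intros refl)+
       (use p1 in \<open>simp only: powrs, simp add: algebra_simps\<close>)
  moreover have "((n + l) * z * (u r * y) + r * z * ((p + 1) * y * (q * U r))) / (p + 1)
      = (n + l) / (p + 1) * (z * (u r * y)) + r * z * y * q * U r"
    using p1 by (simp add: field_simps)
  ultimately show ?thesis
    by (simp add: powrs) (erule DERIV_cong, simp add: field_simps power2_eq_square)
qed

text \<open>Trading each flux for its function by means of the flux bound reduces the limits at both
  ends to the sizes of \<open>u\<close> and \<open>w\<close> alone.\<close>
lemma abs_pohozaev_le:
  "\<exists>D\<ge>0. \<forall>r>0. \<bar>pohozaev r\<bar> \<le> D * (r powr (n - 2) * (u r * - w r)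
      + r powr (n - \<alpha>) * (w r)\<^sup>2 + r powr (n + l) * u r powr (p + 1))"
proof -
  define K :: real where "K = 2 powr (n - 1)"
  define a b where "a = \<bar>(n - \<alpha>) / 2\<bar>" "b = \<bar>(n + \<alpha> - 4) / 2\<bar>"
  define D where "D = K\<^sup>2 + (a + b) * K + 1"
  have nonneg: "0 \<le> K" "0 \<le> a" "0 \<le> b" by (auto simp: K_def a_b_def)
  have "\<bar>pohozaev r\<bar> \<le> D * (r powr (n - 2) * (u r * - w r)
      + r powr (n - \<alpha>) * (w r)\<^sup>2 + r powr (n + l) * u r powr (p + 1))" if r: "0 < r" for r
  proof -
    define X v where "X = - U r" "v = - w r"
    have signs: "0 \<le> X" "0 \<le> v" "0 \<le> W r" "0 \<le> u r"
      using U_nonpos[OF r] w_nonpos[OF r] W_nonneg[OF r] u_nonneg[OF r] by (auto simp: X_v_def)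
    have X: "X \<le> K * r powr (n - 2) * u r"
      using flux_le[where n = n and f = "\<lambda>r. - u r" and F = "\<lambda>r. - U r" and r = r]
        n r U_antimono U_nonpos[OF r] u_nonneg[of "2 * r"]
      by (auto simp: X_v_def K_def intro!: derivative_eq_intros du)
    have Wr: "W r \<le> K * r powr (n - 2) * v"
      unfolding X_v_def K_def using n r dw W_mono W_nonneg[OF r] w_nonpos[of "2 * r"]
      by (intro flux_le) auto
    define q where "q = r powr (n - 2) * (u r * v)"
    have q: "0 \<le> q" using signs by (simp add: q_def)
    have "r powr (2 - n) * X * W r \<le> r powr (2 - n) * (K * r powr (n - 2) * u r) * (K * r powr (n - 2) * v)"
      using X Wr signs by (intro mult_mono mult_left_mono) (auto simp: K_def)
    also have "\<dots> = (r powr (2 - n) * r powr (n - 2)) * K\<^sup>2 * q"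
      by (simp add: q_def power2_eq_square mult_ac)
    also have "r powr (2 - n) * r powr (n - 2) = 1" using r by (simp add: powr_add[symmetric])
    finally have t1: "r powr (2 - n) * X * W r \<le> K\<^sup>2 * q" by simp
    have "X * v \<le> K * r powr (n - 2) * u r * v" using X signs by (intro mult_right_mono)
    then have t2: "X * v \<le> K * q" by (simp add: q_def mult_ac)
    have "u r * W r \<le> u r * (K * r powr (n - 2) * v)" using Wr signs by (intro mult_left_mono)
    then have t3: "u r * W r \<le> K * q" by (simp add: q_def mult_ac)
    define q2 q3 where "q2 = r powr (n - \<alpha>) * v\<^sup>2" "q3 = r powr (n + l) * u r powr (p + 1)"
    have q23: "0 \<le> q2" "0 \<le> q3" by (auto simp: q2_q3_def)
    have "pohozaev r = r powr (2 - n) * X * W r + q2 / 2 + q3 / (p + 1)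
        - (n - \<alpha>) / 2 * (X * v) - (n + \<alpha> - 4) / 2 * (u r * W r)"
      by (simp add: pohozaev_def X_v_def q2_q3_def)
    also have "\<bar>\<dots>\<bar> \<le> \<bar>r powr (2 - n) * X * W r\<bar> + \<bar>q2 / 2\<bar> + \<bar>q3 / (p + 1)\<bar>
        + \<bar>(n - \<alpha>) / 2 * (X * v)\<bar> + \<bar>(n + \<alpha> - 4) / 2 * (u r * W r)\<bar>" by linarith
    also have "\<dots> \<le> K\<^sup>2 * q + q2 + q3 + a * (K * q) + b * (K * q)"
    proof (intro add_mono)
      show "\<bar>r powr (2 - n) * X * W r\<bar> \<le> K\<^sup>2 * q" using t1 signs by simp
      show "\<bar>q2 / 2\<bar> \<le> q2" using q23 by simp
      show "\<bar>q3 / (p + 1)\<bar> \<le> q3" using q23 p by (simp add: divide_le_eq mult_left_le algebra_simps)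
      show "\<bar>(n - \<alpha>) / 2 * (X * v)\<bar> \<le> a * (K * q)"
        unfolding abs_mult[of _ "X * v"] a_b_def using t2 signs by (intro mult_left_mono) auto
      show "\<bar>(n + \<alpha> - 4) / 2 * (u r * W r)\<bar> \<le> b * (K * q)"
        unfolding abs_mult[of _ "u r * W r"] a_b_def using t3 signs by (intro mult_left_mono) auto
    qed
    also have "\<dots> \<le> D * (q + q2 + q3)"
    proof -
      have "0 \<le> (D - 1) * (q2 + q3) + q" unfolding D_def using q q23 nonneg by simp
      then show ?thesis by (simp add: D_def algebra_simps)
    qed
    finally show ?thesis by (simp add: q_def q2_q3_def X_v_def)
  qed
  moreover have "0 \<le> D" using nonneg by (simp add: D_def)
  ultimately show ?thesis by blast
qed

lemma pohozaev_at_0: "(pohozaev \<longlongrightarrow> 0) (at_right 0)"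
proof -
  obtain D where D: "\<And>r. 0 < r \<Longrightarrow> \<bar>pohozaev r\<bar> \<le> D * (r powr (n - 2) * (u r * - w r)
      + r powr (n - \<alpha>) * (w r)\<^sup>2 + r powr (n + l) * u r powr (p + 1))" and D0: "0 \<le> D"
    using abs_pohozaev_le by blast
  have nl: "0 < n + l" using N' \<tau> by simp
  show ?thesis
  proof (rule Lim_null_comparison)
    have "\<forall>\<^sub>F r in at_right 0. r \<in> {0<..<1::real}" by (intro eventually_at_right_real) simp
    then show "\<forall>\<^sub>F r in at_right 0. norm (pohozaev r) \<le> D * (r powr (n - 2) * (B * B)
      + r powr (n - \<alpha>) * B\<^sup>2 + r powr (n + l) * B powr (p + 1))"
    proof eventually_elim
      case (elim r)
      then have r: "0 < r" "r \<le> 1" by auto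
      have "\<bar>w r\<bar>\<^sup>2 \<le> B\<^sup>2" using w_le[OF r] by (intro power_mono) auto
      moreover have "u r powr (p + 1) \<le> B powr (p + 1)"
        using u_le[OF r] u_nonneg[OF r(1)] p by (intro powr_mono2) auto
      moreover have "u r * - w r \<le> B * B"
        using u_le[OF r] u_nonneg[OF r(1)] w_le[OF r] w_nonpos[OF r(1)] by (intro mult_mono) auto
      ultimately have "D * (r powr (n - 2) * (u r * - w r)
          + r powr (n - \<alpha>) * (w r)\<^sup>2 + r powr (n + l) * u r powr (p + 1))
        \<le> D * (r powr (n - 2) * (B * B) + r powr (n - \<alpha>) * B\<^sup>2 + r powr (n + l) * B powr (p + 1))"
        using D0 by (intro mult_left_mono add_mono) auto
      then show ?case using D[OF r(1)] by simp
    qed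
    have lim: "((\<lambda>r. r powr a) \<longlongrightarrow> 0) (at_right 0)" if "0 < a" for a :: real
      using that by real_asymp
    have "((\<lambda>r. D * (r powr (n - 2) * (B * B) + r powr (n - \<alpha>) * B\<^sup>2
        + r powr (n + l) * B powr (p + 1))) \<longlongrightarrow>
        D * (0 * (B * B) + 0 * B\<^sup>2 + 0 * B powr (p + 1))) (at_right 0)"
      using n \<alpha> nl by (intro tendsto_intros lim) auto
    then show "((\<lambda>r. D * (r powr (n - 2) * (B * B) + r powr (n - \<alpha>) * B\<^sup>2
        + r powr (n + l) * B powr (p + 1))) \<longlongrightarrow> 0) (at_right 0)" by simp
  qed
qed

text \<open>By scaling, the decay rates make all three terms of the bound a multiple of the same power
  \<open>r\<^bsup>\<delta>\<^esup>\<close>, and \<open>\<delta> < 0\<close> is once more the subcriticality of \<open>p\<close>.\<close>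
lemma pohozaev_at_top: "(pohozaev \<longlongrightarrow> 0) at_top"
proof -
  obtain D where D: "\<And>r. 0 < r \<Longrightarrow> \<bar>pohozaev r\<bar> \<le> D * (r powr (n - 2) * (u r * - w r)
      + r powr (n - \<alpha>) * (w r)\<^sup>2 + r powr (n + l) * u r powr (p + 1))" and D0: "0 \<le> D"
    using abs_pohozaev_le by blast
  obtain M where M: "0 \<le> M" and u: "\<And>r. 1 \<le> r \<Longrightarrow> u r \<le> M * r powr - \<theta>"
    using u_decay by blast
  define M' where "M' = M * (1/2) powr (\<alpha> - 2 - \<theta>) / flux_const n (n - \<alpha>)"
  have w: "- w r \<le> M' * r powr (\<alpha> - 2 - \<theta>)" if r: "2 \<le> r" for r
  proof -
    define s where "s = r / 2"
    have s: "1 \<le> s" "r = 2 * s" using r by (auto simp: s_def)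
    have "flux_const n (n - \<alpha>) * - w r * s powr (2 - \<alpha>) \<le> M * s powr - \<theta>"
      using w_decay[of s] u[OF s(1)] s by simp
    then have "(flux_const n (n - \<alpha>) * - w r * s powr (2 - \<alpha>)) * s powr (\<alpha> - 2)
        \<le> (M * s powr - \<theta>) * s powr (\<alpha> - 2)" by (intro mult_right_mono) auto
    moreover have "s powr (2 - \<alpha>) * s powr (\<alpha> - 2) = 1"
      using s by (simp add: powr_add[symmetric])
    moreover have "s powr - \<theta> * s powr (\<alpha> - 2) = (1/2) powr (\<alpha> - 2 - \<theta>) * r powr (\<alpha> - 2 - \<theta>)"
    proof -
      have "(1/2) powr (\<alpha> - 2 - \<theta>) * r powr (\<alpha> - 2 - \<theta>) = s powr (\<alpha> - 2 - \<theta>)"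
        unfolding s_def using r by (subst powr_mult[symmetric]) auto
      then show ?thesis by (simp add: powr_add[symmetric] algebra_simps)
    qed
    ultimately have "flux_const n (n - \<alpha>) * - w r
        \<le> M * ((1/2) powr (\<alpha> - 2 - \<theta>) * r powr (\<alpha> - 2 - \<theta>))"
      by (simp add: mult.assoc)
    then show ?thesis
      using flux_const_pos[of n "n - \<alpha>"] by (simp add: M'_def field_simps)
  qed
  define \<delta> where "\<delta> = n + \<alpha> - 4 - 2 * \<theta>"
  have "n + \<alpha> - 4 < 2 * \<theta>"
    using p subcritical by (simp add: \<theta>_def field_simps)
  then have \<delta>: "\<delta> < 0" by (simp add: \<delta>_def)
  show ?thesis
  proof (rule Lim_null_comparison)
    have "\<forall>\<^sub>F r in at_top. 2 \<le> (r::real)" by (rule eventually_ge_at_top)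
    then show "\<forall>\<^sub>F r in at_top. norm (pohozaev r) \<le> D * (M * M' + M'\<^sup>2 + M powr (p + 1)) * r powr \<delta>"
    proof eventually_elim
      case (elim r)
      then have r: "0 < r" "1 \<le> r" by auto
      have q1: "r powr (n - 2) * (u r * - w r) \<le> M * M' * r powr \<delta>"
      proof -
        have "u r * - w r \<le> (M * r powr - \<theta>) * (M' * r powr (\<alpha> - 2 - \<theta>))"
          using u[OF r(2)] w[OF elim] u_nonneg[OF r(1)] w_nonpos[OF r(1)] M
          by (intro mult_mono) auto
        then have "r powr (n - 2) * (u r * - w r)
            \<le> r powr (n - 2) * ((M * r powr - \<theta>) * (M' * r powr (\<alpha> - 2 - \<theta>)))"
          by (intro mult_left_mono) auto
        also have "\<dots> = M * M' * (r powr (n - 2) * r powr - \<theta> * r powr (\<alpha> - 2 - \<theta>))" by simp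
        also have "r powr (n - 2) * r powr - \<theta> * r powr (\<alpha> - 2 - \<theta>) = r powr \<delta>"
          by (simp add: powr_add[symmetric] \<delta>_def algebra_simps)
        finally show ?thesis .
      qed
      have q2: "r powr (n - \<alpha>) * (w r)\<^sup>2 \<le> M'\<^sup>2 * r powr \<delta>"
      proof -
        have "(- w r)\<^sup>2 \<le> (M' * r powr (\<alpha> - 2 - \<theta>))\<^sup>2"
          using w[OF elim] w_nonpos[OF r(1)] by (intro power_mono) auto
        then have "r powr (n - \<alpha>) * (w r)\<^sup>2 \<le> r powr (n - \<alpha>) * (M' * r powr (\<alpha> - 2 - \<theta>))\<^sup>2"
          by (intro mult_left_mono) auto
        also have "\<dots> = M'\<^sup>2 * (r powr (n - \<alpha>) * r powr (\<alpha> - 2 - \<theta>) * r powr (\<alpha> - 2 - \<theta>))"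
          by (simp add: power2_eq_square)
        also have "r powr (n - \<alpha>) * r powr (\<alpha> - 2 - \<theta>) * r powr (\<alpha> - 2 - \<theta>) = r powr \<delta>"
          by (simp add: powr_add[symmetric] \<delta>_def algebra_simps)
        finally show ?thesis .
      qed
      have q3: "r powr (n + l) * u r powr (p + 1) \<le> M powr (p + 1) * r powr \<delta>"
      proof -
        have \<theta>p: "\<theta> * (p + 1) = 4 + l - \<alpha> + 2 * \<theta>" using p by (simp add: \<theta>_def field_simps)
        have "u r powr (p + 1) \<le> (M * r powr - \<theta>) powr (p + 1)"
          using u[OF r(2)] u_nonneg[OF r(1)] p by (intro powr_mono2) auto
        also have "\<dots> = M powr (p + 1) * r powr - (4 + l - \<alpha> + 2 * \<theta>)"
          using M r by (simp add: powr_mult powr_powr \<theta>p[symmetric])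
        finally have "r powr (n + l) * u r powr (p + 1)
            \<le> r powr (n + l) * (M powr (p + 1) * r powr - (4 + l - \<alpha> + 2 * \<theta>))"
          by (intro mult_left_mono) auto
        also have "\<dots> = M powr (p + 1) * (r powr (n + l) * r powr - (4 + l - \<alpha> + 2 * \<theta>))" by simp
        also have "r powr (n + l) * r powr - (4 + l - \<alpha> + 2 * \<theta>) = r powr \<delta>"
          by (simp only: powr_add[symmetric] \<delta>_def) (simp add: algebra_simps)
        finally show ?thesis .
      qed
      have "D * (r powr (n - 2) * (u r * - w r)
          + r powr (n - \<alpha>) * (w r)\<^sup>2 + r powr (n + l) * u r powr (p + 1))
        \<le> D * (M * M' * r powr \<delta> + M'\<^sup>2 * r powr \<delta> + M powr (p + 1) * r powr \<delta>)"
        using D0 q1 q2 q3 by (intro mult_left_mono add_mono) auto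
      also have "\<dots> = D * (M * M' + M'\<^sup>2 + M powr (p + 1)) * r powr \<delta>" by (simp add: algebra_simps)
      finally show ?case using D[OF r(1)] by simp
    qed
    have "((\<lambda>r. r powr \<delta>) \<longlongrightarrow> 0) at_top" using \<delta> by real_asymp
    then show "((\<lambda>r. D * (M * M' + M'\<^sup>2 + M powr (p + 1)) * r powr \<delta>) \<longlongrightarrow> 0) at_top"
      by (rule tendsto_mult_right_zero)
  qed
qed

text \<open>For positive \<open>u\<close> the Pohozaev function would increase strictly from the limit \<open>0\<close> to the
  limit \<open>0\<close>.\<close>
theorem u_eq_0:
  assumes "0 < r"
  shows "u r = 0"
proof (rule ccontr)
  assume "u r \<noteq> 0"
  then have pos: "0 < u x" if "0 < x" for x
    using zero_of_zero[OF that _ assms] u_nonneg[OF that] by fastforce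
  define \<kappa> where "\<kappa> = (n + l) / (p + 1) - (n + \<alpha> - 4) / 2"
  have \<kappa>: "0 < \<kappa>" using p subcritical by (simp add: \<kappa>_def field_simps)
  have strict: "pohozaev x < pohozaev y" if "0 < x" "x < y" for x y
  proof (rule DERIV_pos_imp_increasing[OF that(2)])
    fix t assume "x \<le> t" "t \<le> y"
    then have t: "0 < t" using that by simp
    have "0 < \<kappa> * (t powr (n + l - 1) * u t powr (p + 1))"
      using \<kappa> t pos[OF t] by simp
    then show "\<exists>d. (pohozaev has_real_derivative d) (at t) \<and> 0 < d"
      using pohozaev_DERIV[OF t pos[OF t]] unfolding \<kappa>_def by blast
  qed
  have "0 \<le> pohozaev 1"
  proof (rule tendsto_upperbound[OF pohozaev_at_0])
    have "\<forall>\<^sub>F r in at_right 0. r \<in> {0<..<1::real}" by (intro eventually_at_right_real) simp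
    then show "\<forall>\<^sub>F r in at_right 0. pohozaev r \<le> pohozaev 1"
      by eventually_elim (use strict in \<open>auto intro: less_imp_le\<close>)
  qed simp
  moreover have "pohozaev 2 \<le> 0"
  proof (rule tendsto_lowerbound[OF pohozaev_at_top])
    have "\<forall>\<^sub>F r in at_top. 2 < (r::real)" by (rule eventually_gt_at_top)
    then show "\<forall>\<^sub>F r in at_top. pohozaev 2 \<le> pohozaev r"
      by eventually_elim (use strict in \<open>auto intro: less_imp_le\<close>)
  qed simp
  moreover have "pohozaev 1 < pohozaev 2" by (rule strict) auto
  ultimately show False by simp
qed

end

section \<open>From radial solutions to the system\<close>

text \<open>Restricting to the ray through a basis vector turns the partial differential equation into a
  pair of second order ordinary ones. The bound \<open>B\<close> near the origin comes from the
  continuity of \<open>u\<close> and of the extension of \<open>|x|\<^bsup>\<alpha>\<^esup> \<Delta>u\<close> on the closed unit ball.\<close>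
lemma profile_system:
  fixes u :: "'a::euclidean_space \<Rightarrow> real" and n \<alpha> l p :: real
  defines "n \<equiv> real DIM('a)"
  assumes sol: "nonneg_solution \<alpha> l p u" and rad: "radial u" and b: "b \<in> Basis"
  obtains g1 w w1 B where
    "\<And>s. 0 < s \<Longrightarrow> ((\<lambda>s. u (s *\<^sub>R b)) has_real_derivative g1 s) (at s)"
    "\<And>s. 0 < s \<Longrightarrow> (g1 has_real_derivative s powr - \<alpha> * w s - (n - 1) / s * g1 s) (at s)"
    "\<And>s. 0 < s \<Longrightarrow> (w has_real_derivative w1 s) (at s)"
    "\<And>s. 0 < s \<Longrightarrow> (w1 has_real_derivative
        s powr l * u (s *\<^sub>R b) powr p - (n - 1) / s * w1 s) (at s)"
    "\<And>s. 0 < s \<Longrightarrow> s \<le> 1 \<Longrightarrow> u (s *\<^sub>R b) \<le> B"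
    "\<And>s. 0 < s \<Longrightarrow> s \<le> 1 \<Longrightarrow> \<bar>w s\<bar> \<le> B"
proof -
  define g where "g = (\<lambda>s. u (s *\<^sub>R b))"
  define D where "D = partial_deriv b"
  define g1 g2 g3 g4 where "g1 = (\<lambda>s. D u (s *\<^sub>R b))" "g2 = (\<lambda>s. D (D u) (s *\<^sub>R b))"
    "g3 = (\<lambda>s. D (D (D u)) (s *\<^sub>R b))" "g4 = (\<lambda>s. D (D (D (D u))) (s *\<^sub>R b))"
  note g_defs = g_def this
  have "C_k_on (Suc (Suc (Suc (Suc 0)))) (- {0}) u"
    using sol by (simp add: nonneg_solution_def numeral_eq_Suc)
  then have C: "C_k_on (Suc 3) (- {0}) u" "C_k_on (Suc 2) (- {0}) (D u)"
    "C_k_on (Suc 1) (- {0}) (D (D u))" "C_k_on (Suc 0) (- {0}) (D (D (D u)))"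
    using b by (auto simp: D_def numeral_eq_Suc)
  have dg: "(g has_real_derivative g1 s) (at s)" "(g1 has_real_derivative g2 s) (at s)"
    "(g2 has_real_derivative g3 s) (at s)" "(g3 has_real_derivative g4 s) (at s)"
    if "0 < s" for s
    unfolding g_defs using C[THEN C_k_on_ray_DERIV, OF b that] by (simp_all add: D_def)
  have norm_b: "norm b = 1" using b by simp
  have u_eq: "u x = g (norm x)" for x
    using rad norm_b by (auto simp: radial_def g_def)
  have lap_u: "laplacian u x = g2 (norm x) + (n - 1) / norm x * g1 (norm x)" if "x \<noteq> 0" for x
    unfolding n_def using that by (intro laplacian_radial[where h = g]) (auto simp: u_eq dg)
  define w where "w s = s powr \<alpha> * (g2 s + (n - 1) / s * g1 s)" for s
  define w1 where "w1 s = \<alpha> * s powr (\<alpha> - 1) * (g2 s + (n - 1) / s * g1 s)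
    + s powr \<alpha> * (g3 s + (n - 1) / s * g2 s - (n - 1) / s\<^sup>2 * g1 s)" for s
  have dw: "(w has_real_derivative w1 s) (at s)" if "0 < s" for s
    unfolding w_def[abs_def] w1_def using that
    by (auto intro!: derivative_eq_intros dg simp: field_simps power2_eq_square)
  \<comment> \<open>The value of \<open>w''\<close> follows from the equation below; here only its existence matters.\<close>
  have "\<exists>w2. (w1 has_real_derivative w2) (at s)" if "0 < s" for s
    unfolding w1_def[abs_def] using that
    by (intro exI) (rule derivative_eq_intros dg refl | simp)+
  then obtain w2 where dw1: "\<And>s. 0 < s \<Longrightarrow> (w1 has_real_derivative w2 s) (at s)" by metis
  define f where "f y = norm y powr \<alpha> * laplacian u y" for y
  have f_eq: "f y = w (norm y)" if "y \<noteq> 0" for y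
    by (simp add: f_def w_def lap_u[OF that])
  have eq: "w2 s + (n - 1) / s * w1 s = s powr l * g s powr p" if s: "0 < s" for s
  proof -
    have ne: "s *\<^sub>R b \<noteq> 0" using s norm_b by auto
    have ns: "norm (s *\<^sub>R b) = s" using s norm_b by simp
    have "laplacian f (s *\<^sub>R b) = norm (s *\<^sub>R b) powr l * u (s *\<^sub>R b) powr p"
      using sol ne unfolding nonneg_solution_def f_def by blast
    moreover have "laplacian f (s *\<^sub>R b) = w2 s + (n - 1) / s * w1 s"
      using laplacian_radial[where f = f, OF f_eq dw dw1 ne] unfolding ns n_def by simp
    ultimately show ?thesis by (simp only: ns g_def)
  qed
  have "continuous_on UNIV u" using sol by (simp add: nonneg_solution_def)
  moreover obtain G where G: "continuous_on UNIV G" "\<And>x. x \<noteq> 0 \<Longrightarrow> G x = f x"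
    using sol unfolding nonneg_solution_def extends_continuously_def f_def by blast
  ultimately have "continuous_on (cball 0 1) (\<lambda>x. (u x, G x))"
    by (intro continuous_on_Pair) (auto intro: continuous_on_subset)
  then have "bounded ((\<lambda>x. (u x, G x)) ` cball 0 1)"
    by (intro compact_imp_bounded compact_continuous_image) auto
  then obtain B where "\<forall>x\<in>cball 0 1. norm (u x, G x) \<le> B"
    by (auto simp: bounded_iff)
  then have B: "norm (u x, G x) \<le> B" if "norm x \<le> 1" for x
    using that by simp
  show thesis
  proof
    fix s :: real assume s: "0 < s"
    show "((\<lambda>s. u (s *\<^sub>R b)) has_real_derivative g1 s) (at s)"
      using dg(1)[OF s] by (simp add: g_def)
    show "(g1 has_real_derivative s powr - \<alpha> * w s - (n - 1) / s * g1 s) (at s)"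
      using dg(2)[OF s] s by (simp add: w_def powr_add[symmetric] mult.assoc[symmetric])
    show "(w has_real_derivative w1 s) (at s)" by (rule dw[OF s])
    have "s powr l * u (s *\<^sub>R b) powr p - (n - 1) / s * w1 s = w2 s"
      using eq[OF s] by (simp add: g_def)
    then show "(w1 has_real_derivative s powr l * u (s *\<^sub>R b) powr p - (n - 1) / s * w1 s) (at s)"
      using dw1[OF s] by simp
    assume "s \<le> 1"
    then have "norm (s *\<^sub>R b) \<le> 1" using s norm_b by simp
    then have le: "norm (u (s *\<^sub>R b)) \<le> B" "norm (G (s *\<^sub>R b)) \<le> B"
      using B[of "s *\<^sub>R b"] norm_fst_le[of "u (s *\<^sub>R b)" "G (s *\<^sub>R b)"]
        norm_snd_le[of "G (s *\<^sub>R b)" "u (s *\<^sub>R b)"] by auto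
    have "s *\<^sub>R b \<noteq> 0" using s norm_b by auto
    then have "G (s *\<^sub>R b) = w s" using s norm_b by (simp add: G(2) f_eq)
    with le show "u (s *\<^sub>R b) \<le> B" "\<bar>w s\<bar> \<le> B" by auto
  qed
qed

text \<open>The integrating factor \<open>s\<^bsup>n-1\<^esup>\<close> removes the first order term of the radial Laplacian.\<close>
lemma DERIV_flux:
  fixes n s :: real
  assumes s: "0 < s" and d: "(g has_real_derivative d - (n - 1) / s * g s) (at s)"
  shows "((\<lambda>s. s powr (n - 1) * g s) has_real_derivative s powr (n - 1) * d) (at s)"
proof -
  have "s powr (n - 2) = s powr (n - 1) / s"
    using s powr_diff[of s "n - 1" 1] by simp
  then have "(n - 1) * s powr (n - 1 - 1) * g s + (d - (n - 1) / s * g s) * s powr (n - 1)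
      = s powr (n - 1) * d"
    by (simp add: algebra_simps)
  with DERIV_mult[OF has_real_derivative_powr[OF s, of "n - 1"] d] show ?thesis
    by simp
qed

theorem theorem1p2:
  fixes \<alpha> l N' \<tau> p\<^sub>s p :: real
    and u :: "real ^ 'n \<Rightarrow> real"
  assumes "CARD('n) \<ge> 5"
    and "N' = real CARD('n) + \<alpha>"
    and "\<tau> = l - \<alpha>"
    and "2 * real CARD('n) > N'"
    and "N' > 4"
    and "\<tau> > -4"
    and "p\<^sub>s = (N' + 4 + 2 * \<tau>) / (N' - 4)"
    and "1 < p"
    and "p < p\<^sub>s"
    and "nonneg_solution \<alpha> l p u"
    and "radial u"
  shows "\<forall>x. u x = 0"
proof -
  define n where "n = real DIM(real ^ 'n)"
  have n: "n = real CARD('n)" by (simp add: n_def)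
  obtain b :: "real ^ 'n" where b: "b \<in> Basis" using nonempty_Basis by blast
  obtain g1 w w1 B where
    du: "\<And>s. 0 < s \<Longrightarrow> ((\<lambda>s. u (s *\<^sub>R b)) has_real_derivative g1 s) (at s)" and
    dg1: "\<And>s. 0 < s \<Longrightarrow> (g1 has_real_derivative s powr - \<alpha> * w s - (n - 1) / s * g1 s) (at s)" and
    dw: "\<And>s. 0 < s \<Longrightarrow> (w has_real_derivative w1 s) (at s)" and
    dw1: "\<And>s. 0 < s \<Longrightarrow> (w1 has_real_derivative
        s powr l * u (s *\<^sub>R b) powr p - (n - 1) / s * w1 s) (at s)" and
    B: "\<And>s. 0 < s \<Longrightarrow> s \<le> 1 \<Longrightarrow> u (s *\<^sub>R b) \<le> B" "\<And>s. 0 < s \<Longrightarrow> s \<le> 1 \<Longrightarrow> \<bar>w s\<bar> \<le> B"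
    using profile_system[OF assms(10,11) b] unfolding n_def by blast
  have unit: "s powr (1 - n) * (s powr (n - 1) * c) = c" if "0 < s" for s c
    using that by (simp add: mult.assoc[symmetric] powr_add[symmetric])
  interpret radial_system n \<alpha> l p B "\<lambda>s. u (s *\<^sub>R b)" "\<lambda>s. s powr (n - 1) * g1 s" w
    "\<lambda>s. s powr (n - 1) * w1 s"
  proof
    have "p * (N' - 4) < N' + 4 + 2 * \<tau>"
      using assms by (simp add: less_divide_eq)
    then show "(p - 1) * (n + \<alpha> - 4) < 2 * (4 + l - \<alpha>)"
      using assms(2,3) by (simp add: n algebra_simps)
    fix s :: real assume s: "0 < s"
    show "((\<lambda>s. u (s *\<^sub>R b)) has_real_derivative s powr (1 - n) * (s powr (n - 1) * g1 s)) (at s)"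
      "(w has_real_derivative s powr (1 - n) * (s powr (n - 1) * w1 s)) (at s)"
      using du[OF s] dw[OF s] by (simp_all add: unit[OF s])
    show "((\<lambda>s. s powr (n - 1) * g1 s) has_real_derivative s powr (n - 1 - \<alpha>) * w s) (at s)"
      using DERIV_flux[OF s dg1[OF s]] by (simp add: mult.assoc[symmetric] powr_add[symmetric])
    show "((\<lambda>s. s powr (n - 1) * w1 s) has_real_derivative
        s powr (n - 1 + l) * u (s *\<^sub>R b) powr p) (at s)"
      using DERIV_flux[OF s dw1[OF s]] by (simp add: mult.assoc[symmetric] powr_add[symmetric])
    show "0 \<le> u (s *\<^sub>R b)" using assms(10) by (simp add: nonneg_solution_def)
  qed (use assms n B in auto)
  have zero: "u x = 0" if "x \<noteq> 0" for x
  proof -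
    have "norm (norm x *\<^sub>R b) = norm x" using b by simp
    then have "u x = u (norm x *\<^sub>R b)" using assms(11) by (metis radial_def)
    then show ?thesis using u_eq_0[of "norm x"] that by simp
  qed
  \<comment> \<open>The system lives on \<open>r > 0\<close>; the origin follows by continuity.\<close>
  have "continuous_on UNIV u" using assms(10) by (simp add: nonneg_solution_def)
  then have "(u \<longlongrightarrow> u 0) (at 0)" by (simp add: continuous_on_def)
  moreover have "(u \<longlongrightarrow> 0) (at 0)"
    by (rule tendsto_eventually) (auto simp: eventually_at_filter zero)
  ultimately have "u 0 = 0" by (rule LIM_unique)
  with zero show ?thesis by metis
qed

end
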